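(* For any metric space $X$, $\dim_N(X)\le\dim_L(X)$.
   Context: Nagata dimension: a family of subsets $\{B_i\}$ of $X$ is $D$-bounded if each $B_i$ has diameter $\le D$. For $s>0$, the family has $s$-multiplicity at most $n$ if every subset of $X$ with diameter $\le s$ meets at most $n$ members of the family. The Nagata dimension $\dim_N(X)$ is the minimal integer $n\ge0$ with the property that there exists $c>0$ such that, for all $s>0$, $X$ has a $cs$-bounded covering with $s$-multiplicity at most $n+1$ ($\infty$ if there is no such $n$). Lipschitz dimension: for $r>0$, an $r$-path in a metric space $X$ is a finite sequence $(x_1,\dots,x_k)$ in $X$ with $d(x_i,x_{i+1})\le r$ for $1\le i\le k-1$. Two points are in the same $r$-component of $X$ if some $r$-path in $X$ contains both. The $r$-components of a subset are those of the subset as a metric space. A map $f\colon X\to Y$ is Lipschitz light if there is $C>0$ such that $f$ is $C$-Lipschitz and, for every $r>0$ and every $W\subset Y$ with $\mathrm{diam}(W)\le r$, the $r$-components of $f^{-1}(W)$ have diameter at most $Cr$. $\dim_L(X)$ is the minimal integer $n\ge0$ such that there is a Lipschitz light map $X\to\mathbb{R}^n$ (with $\mathbb{R}^0$ a one-point space), or $\infty$ if there is none. *)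

theory Defs
  imports "HOL-Analysis.Analysis"
begin

(* Valued in ennreal, so that unbounded sets have diameter infinity; the library's
   real-valued diameter is unspecified on those. The empty set has diameter 0. *)
definition mdiam :: "'a metric \<Rightarrow> 'a set \<Rightarrow> ennreal" where
  "mdiam X S = (SUP x\<in>S. SUP y\<in>S. ennreal (mdist X x y))"

lemma mdiam_le_iff:
  assumes "0 \<le> r"
  shows "mdiam X S \<le> ennreal r \<longleftrightarrow> (\<forall>x\<in>S. \<forall>y\<in>S. mdist X x y \<le> r)"
  using assms by (simp add: mdiam_def SUP_le_iff)

(* Families are sets of subsets: passing from an indexed family to its range removes
   repetitions, so it does not increase the multiplicity. *)
definition covering :: "'a metric \<Rightarrow> 'a set set \<Rightarrow> bool" where
  "covering X \<B> \<longleftrightarrow> (\<forall>B\<in>\<B>. B \<subseteq> mspace X) \<and> \<Union>\<B> = mspace X"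

definition family_bounded :: "'a metric \<Rightarrow> real \<Rightarrow> 'a set set \<Rightarrow> bool" where
  "family_bounded X D \<B> \<longleftrightarrow> (\<forall>B\<in>\<B>. mdiam X B \<le> ennreal D)"

definition multiplicity_at_most :: "'a metric \<Rightarrow> real \<Rightarrow> nat \<Rightarrow> 'a set set \<Rightarrow> bool" where
  "multiplicity_at_most X s n \<B> \<longleftrightarrow>
     (\<forall>A. A \<subseteq> mspace X \<and> mdiam X A \<le> ennreal s \<longrightarrow>
          finite {B\<in>\<B>. B \<inter> A \<noteq> {}} \<and> card {B\<in>\<B>. B \<inter> A \<noteq> {}} \<le> n)"

(* In enat, the infimum of the empty set is infinity, and that of a nonempty set is its minimum. *)
definition nagata_dim :: "'a metric \<Rightarrow> enat" where
  "nagata_dim X = Inf {enat n | n. \<exists>c>0. \<forall>s>0. \<exists>\<B>.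
     covering X \<B> \<and> family_bounded X (c * s) \<B> \<and> multiplicity_at_most X s (n + 1) \<B>}"

definition r_path :: "'a metric \<Rightarrow> real \<Rightarrow> 'a list \<Rightarrow> bool" where
  "r_path X r xs \<longleftrightarrow> xs \<noteq> [] \<and> set xs \<subseteq> mspace X \<and>
     (\<forall>i. Suc i < length xs \<longrightarrow> mdist X (xs ! i) (xs ! Suc i) \<le> r)"

definition r_connected :: "'a metric \<Rightarrow> real \<Rightarrow> ('a \<times> 'a) set" where
  "r_connected X r = {(x, y). \<exists>xs. r_path X r xs \<and> x \<in> set xs \<and> y \<in> set xs}"

definition r_components :: "'a metric \<Rightarrow> real \<Rightarrow> 'a set set" where
  "r_components X r = mspace X // r_connected X r"

definition lipschitz_light :: "'a metric \<Rightarrow> 'b metric \<Rightarrow> ('a \<Rightarrow> 'b) \<Rightarrow> bool" where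
  "lipschitz_light X Y f \<longleftrightarrow> f \<in> mspace X \<rightarrow> mspace Y \<and>
     (\<exists>C>0. (\<forall>x\<in>mspace X. \<forall>y\<in>mspace X. mdist Y (f x) (f y) \<le> C * mdist X x y) \<and>
        (\<forall>r>0. \<forall>W. W \<subseteq> mspace Y \<and> mdiam Y W \<le> ennreal r \<longrightarrow>
           (\<forall>K \<in> r_components (submetric X {x \<in> mspace X. f x \<in> W}) r.
              mdiam X K \<le> ennreal (C * r))))"

(* R^n with its Euclidean distance, for n a term: as in the library's Euclidean_space topology,
   points are the real sequences vanishing from index n on. For n = 0 this is a single point. *)
definition Rn_metric :: "nat \<Rightarrow> (nat \<Rightarrow> real) metric" where
  "Rn_metric n = metric ({x. \<forall>i\<ge>n. x i = 0}, \<lambda>x y. L2_set (\<lambda>i. x i - y i) {..<n})"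

lemma Metric_space_Rn:
  "Metric_space {x :: nat \<Rightarrow> real. \<forall>i\<ge>n. x i = 0} (\<lambda>x y. L2_set (\<lambda>i. x i - y i) {..<n})"
proof
  fix x y z :: "nat \<Rightarrow> real"
  show "0 \<le> L2_set (\<lambda>i. x i - y i) {..<n}" by simp
  show "L2_set (\<lambda>i. x i - y i) {..<n} = L2_set (\<lambda>i. y i - x i) {..<n}"
    by (simp add: L2_set_def power2_commute)
  assume x: "x \<in> {x. \<forall>i\<ge>n. x i = 0}" and y: "y \<in> {x. \<forall>i\<ge>n. x i = 0}"
  show "L2_set (\<lambda>i. x i - y i) {..<n} = 0 \<longleftrightarrow> x = y"
  proof
    assume "L2_set (\<lambda>i. x i - y i) {..<n} = 0"
    then have "\<forall>i<n. x i = y i" by (simp add: L2_set_eq_0_iff)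
    moreover have "x i = y i" if "\<not> i < n" for i
      using x y that by simp
    ultimately show "x = y" by (intro ext) blast
  qed (simp add: L2_set_0')
  have "L2_set (\<lambda>i. (x i - y i) + (y i - z i)) {..<n}
      \<le> L2_set (\<lambda>i. x i - y i) {..<n} + L2_set (\<lambda>i. y i - z i) {..<n}"
    by (rule L2_set_triangle_ineq)
  then show "L2_set (\<lambda>i. x i - z i) {..<n}
      \<le> L2_set (\<lambda>i. x i - y i) {..<n} + L2_set (\<lambda>i. y i - z i) {..<n}" by simp
qed

lemma mspace_Rn [simp]: "mspace (Rn_metric n) = {x. \<forall>i\<ge>n. x i = 0}"
  unfolding Rn_metric_def by (rule Metric_space.mspace_metric [OF Metric_space_Rn])

lemma mdist_Rn [simp]: "mdist (Rn_metric n) = (\<lambda>x y. L2_set (\<lambda>i. x i - y i) {..<n})"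
  unfolding Rn_metric_def by (rule Metric_space.mdist_metric [OF Metric_space_Rn])

definition lipschitz_dim :: "'a metric \<Rightarrow> enat" where
  "lipschitz_dim X = Inf {enat n | n. \<exists>f. lipschitz_light X (Rn_metric n) f}"

end

theory Submission
  imports Defs
begin

text \<open>
  The inequality is the combination of two facts. First, Nagata dimension does not increase when
  one passes to the domain of a Lipschitz light map \<open>f\<close>: pull a covering of the target back along
  \<open>f\<close> and cut every preimage into its \<open>r\<close>-components, for \<open>r\<close> at least the scale \<open>s\<close> at which
  multiplicity is tested and at least the size of the covering sets. Lightness bounds the pieces
  linearly in \<open>r\<close>. A test set of diameter at most \<open>s\<close> cannot meet two \<open>r\<close>-components of the same
  preimage, and its image under \<open>f\<close> is small, so the cutting does not cost any multiplicity
  (lemma \<open>nagata_dim_le_of_lipschitz_light\<close>).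

  Second, \<open>\<real>\<^sup>n\<close> has Nagata dimension at most \<open>n\<close>. This uses Kolmogorov's \<open>n + 1\<close> families of cubes:
  at scale \<open>t\<close> cut the line into half-open intervals of length \<open>t\<close>, numbered by the integers, and colour them
  periodically with colours \<open>0, \<dots>, n\<close>. Deleting the intervals of colour \<open>k\<close> leaves blocks of length
  \<open>n t\<close>, and points of different blocks are more than \<open>t\<close> apart; family \<open>k\<close> consists of the \<open>n\<close>-fold products of these
  blocks. Each coordinate of a point forbids only one colour, so some colour out of \<open>n + 1\<close> remains
  and every point is covered; by the separation, a set of diameter at most \<open>t\<close> meets at most one
  member of each family (lemma \<open>nagata_dim_Rn_le\<close>).
\<close>

section \<open>Components at a given scale\<close>

text \<open>
  Membership of two points in a common path is awkward to compose, because the points may sit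
  anywhere in the path and in either order; the reflexive transitive closure composes freely.
\<close>

lemma r_connected_eq_rtrancl:
  "r_connected X r =
     {(x, y). x \<in> mspace X \<and>
        (x, y) \<in> {(u, v). u \<in> mspace X \<and> v \<in> mspace X \<and> mdist X u v \<le> r}\<^sup>*}"
    (is "_ = {(x, y). x \<in> mspace X \<and> (x, y) \<in> ?E\<^sup>*}")
proof (intro set_eqI iffI; clarify)
  fix x y assume "(x, y) \<in> r_connected X r"
  then obtain xs where xs: "r_path X r xs" "x \<in> set xs" "y \<in> set xs"
    by (auto simp: r_connected_def)
  have sym: "sym (?E\<^sup>*)"
    by (rule sym_rtrancl) (auto simp: sym_def mdist_commute)
  have forward: "(xs ! i, xs ! (i + k)) \<in> ?E\<^sup>*" if "i + k < length xs" for i k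
    using that
  proof (induction k)
    case (Suc k)
    have "(xs ! (i + k), xs ! (i + Suc k)) \<in> ?E"
      using xs(1) Suc.prems by (auto simp: r_path_def dest: nth_mem)
    with Suc show ?case by (auto intro: rtrancl.rtrancl_into_rtrancl)
  qed simp
  obtain i j where ij: "i < length xs" "j < length xs" "x = xs ! i" "y = xs ! j"
    using xs by (metis in_set_conv_nth)
  have "(x, y) \<in> ?E\<^sup>*"
  proof (cases "i \<le> j")
    case True
    then show ?thesis using forward[of i "j - i"] ij by simp
  next
    case False
    then have "(y, x) \<in> ?E\<^sup>*" using forward[of j "i - j"] ij by simp
    then show ?thesis using sym by (auto dest: symD)
  qed
  moreover have "x \<in> mspace X" using xs by (auto simp: r_path_def)
  ultimately show "x \<in> mspace X \<and> (x, y) \<in> ?E\<^sup>*" by blast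
next
  fix x y assume x: "x \<in> mspace X" and "(x, y) \<in> ?E\<^sup>*"
  from this(2) have "\<exists>xs. r_path X r xs \<and> x \<in> set xs \<and> last xs = y"
  proof induction
    case base
    then show ?case using x by (intro exI[of _ "[x]"]) (simp add: r_path_def)
  next
    case (step y z)
    then obtain xs where xs: "r_path X r xs" "x \<in> set xs" "last xs = y" by blast
    have "mdist X ((xs @ [z]) ! i) ((xs @ [z]) ! Suc i) \<le> r" if "Suc i < length (xs @ [z])" for i
    proof (cases "Suc i < length xs")
      case True
      then show ?thesis using xs(1) by (auto simp: r_path_def nth_append)
    next
      case False
      with that have "Suc i = length xs" by simp
      moreover from this have "xs ! i = y"
        using xs(1,3) by (metis diff_Suc_1 last_conv_nth r_path_def)
      ultimately show ?thesis using step(2) by (auto simp: nth_append)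
    qed
    then have "r_path X r (xs @ [z])" using xs(1) step(2) by (auto simp: r_path_def)
    then show ?case using xs(2) by (intro exI[of _ "xs @ [z]"]) simp
  qed
  then obtain xs where "r_path X r xs" "x \<in> set xs" "last xs = y" by blast
  moreover from this have "y \<in> set xs" by (auto simp: r_path_def)
  ultimately show "(x, y) \<in> r_connected X r" by (auto simp: r_connected_def)
qed

lemma equiv_r_connected: "equiv (mspace X) (r_connected X r)"
proof (rule equivI)
  let ?E = "{(u, v). u \<in> mspace X \<and> v \<in> mspace X \<and> mdist X u v \<le> r}"
  have mem: "y \<in> mspace X" if "(x, y) \<in> ?E\<^sup>*" "x \<in> mspace X" for x y
    using that by induction auto
  show "r_connected X r \<subseteq> mspace X \<times> mspace X"
    by (auto simp: r_connected_eq_rtrancl dest: mem)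
  show "refl_on (mspace X) (r_connected X r)"
    by (auto simp: refl_on_def r_connected_eq_rtrancl)
  show "sym (r_connected X r)" by (auto simp: sym_def r_connected_def)
  show "trans (r_connected X r)"
    by (auto simp: trans_def r_connected_eq_rtrancl intro: rtrancl_trans)
qed

lemma Union_r_components: "\<Union>(r_components X r) = mspace X"
  unfolding r_components_def by (rule Union_quotient[OF equiv_r_connected])

text \<open>Two points at distance at most \<open>r\<close> already form an \<open>r\<close>-path.\<close>

lemma r_components_eq_if_close:
  assumes K: "K \<in> r_components X r" "K' \<in> r_components X r"
    and xy: "x \<in> K" "y \<in> K'" "mdist X x y \<le> r"
  shows "K = K'"
proof -
  have "x \<in> mspace X" "y \<in> mspace X"
    using K xy Union_r_components[of X r] by blast+
  then have "(x, y) \<in> r_connected X r"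
    using xy by (auto simp: r_connected_eq_rtrancl)
  then show ?thesis
    using quotient_eqI[OF equiv_r_connected] K xy unfolding r_components_def by metis
qed

section \<open>Pulling coverings back along Lipschitz light maps\<close>

lemma light_pullback_covering:
  assumes "covering Y \<B>" and f: "f \<in> mspace X \<rightarrow> mspace Y"
  shows "covering X (\<Union>W\<in>\<B>. r_components (submetric X {x \<in> mspace X. f x \<in> W}) r)"
    (is "covering X (\<Union>W\<in>\<B>. ?comp W)")
proof -
  have U: "\<Union>(?comp W) = {x \<in> mspace X. f x \<in> W}" for W
    unfolding Union_r_components by auto
  have cover: "x \<in> \<Union>(\<Union>W\<in>\<B>. ?comp W)" if x: "x \<in> mspace X" for x
  proof -
    have "f x \<in> \<Union>\<B>" using assms x by (auto simp: covering_def)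
    then obtain W where "W \<in> \<B>" "f x \<in> W" by blast
    then have "x \<in> \<Union>(?comp W)" using x by (simp add: U)
    then show ?thesis using \<open>W \<in> \<B>\<close> by blast
  qed
  have inside: "K \<subseteq> mspace X" if "K \<in> (\<Union>W\<in>\<B>. ?comp W)" for K
  proof -
    from that obtain W where "K \<in> ?comp W" by blast
    then have "K \<subseteq> \<Union>(?comp W)" by (rule Union_upper)
    then show ?thesis unfolding U by blast
  qed
  show ?thesis
    unfolding covering_def
  proof (intro conjI ballI equalityI)
    show "\<Union>(\<Union>W\<in>\<B>. ?comp W) \<subseteq> mspace X" using inside by (rule Union_least)
    show "mspace X \<subseteq> \<Union>(\<Union>W\<in>\<B>. ?comp W)" using cover by (rule subsetI)
  qed (rule inside)
qed

lemma finite_card_le_one: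
  assumes "\<And>x y. x \<in> S \<Longrightarrow> y \<in> S \<Longrightarrow> x = y"
  shows "finite S \<and> card S \<le> 1"
proof (cases "S = {}")
  case False
  then obtain x where "x \<in> S" by blast
  with assms have "S = {x}" by blast
  then show ?thesis by simp
qed simp

text \<open>
  Each covering set of \<open>Y\<close> met by the image of a test set contributes at most one component,
  since the test set is too small to reach a second one.
\<close>

lemma light_pullback_multiplicity:
  assumes f: "f \<in> mspace X \<rightarrow> mspace Y"
    and lip: "\<forall>x\<in>mspace X. \<forall>y\<in>mspace X. mdist Y (f x) (f y) \<le> C * mdist X x y"
    and C: "0 < C" and s: "0 < s" "s \<le> r"
    and mult: "multiplicity_at_most Y (C * s) n \<B>"
  shows "multiplicity_at_most X s n
           (\<Union>W\<in>\<B>. r_components (submetric X {x \<in> mspace X. f x \<in> W}) r)"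
    (is "multiplicity_at_most X s n (\<Union>W\<in>\<B>. ?comp W)")
  unfolding multiplicity_at_most_def
proof (intro allI impI, elim conjE)
  fix A assume A: "A \<subseteq> mspace X" "mdiam X A \<le> ennreal s"
  then have dA: "mdist X x y \<le> s" if "x \<in> A" "y \<in> A" for x y
    using s that by (simp add: mdiam_le_iff)
  have dfA: "mdist Y (f x) (f y) \<le> C * s" if "x \<in> A" "y \<in> A" for x y
  proof -
    have "mdist Y (f x) (f y) \<le> C * mdist X x y" using lip A that by blast
    also have "\<dots> \<le> C * s" using dA[OF that] C by simp
    finally show ?thesis .
  qed
  let ?F = "{W\<in>\<B>. W \<inter> f ` A \<noteq> {}}"
  have "mdiam Y (f ` A) \<le> ennreal (C * s)"
    using C s dfA by (subst mdiam_le_iff) auto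
  moreover have "f ` A \<subseteq> mspace Y" using A f by auto
  ultimately have F: "finite ?F" and card_F: "card ?F \<le> n"
    using mult by (auto simp: multiplicity_at_most_def)
  let ?M = "\<lambda>W. {K \<in> ?comp W. K \<inter> A \<noteq> {}}"
  have sub: "{K \<in> (\<Union>W\<in>\<B>. ?comp W). K \<inter> A \<noteq> {}} \<subseteq> (\<Union>W\<in>?F. ?M W)"
  proof (rule subsetI)
    fix K assume "K \<in> {K \<in> (\<Union>W\<in>\<B>. ?comp W). K \<inter> A \<noteq> {}}"
    then obtain W z where W: "W \<in> \<B>" and K: "K \<in> ?comp W" and z: "z \<in> K" "z \<in> A"
      by blast
    have "K \<subseteq> {x \<in> mspace X. f x \<in> W}"
      using K Union_r_components[of "submetric X {x \<in> mspace X. f x \<in> W}" r] by auto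
    then show "K \<in> (\<Union>W\<in>?F. ?M W)" using W K z by blast
  qed
  have one: "finite (?M W) \<and> card (?M W) \<le> 1" for W
  proof (rule finite_card_le_one)
    fix K K' assume K: "K \<in> ?M W" and K': "K' \<in> ?M W"
    obtain x y where xy: "x \<in> K" "x \<in> A" "y \<in> K'" "y \<in> A" using K K' by blast
    then have close: "mdist (submetric X {x \<in> mspace X. f x \<in> W}) x y \<le> r"
      using dA[of x y] s by simp
    have "K \<in> ?comp W" "K' \<in> ?comp W" using K K' by simp_all
    then show "K = K'" by (rule r_components_eq_if_close[OF _ _ xy(1,3) close])
  qed
  have fin: "finite (\<Union>W\<in>?F. ?M W)" using F one by blast
  have "card (\<Union>W\<in>?F. ?M W) \<le> (\<Sum>W\<in>?F. card (?M W))" by (rule card_UN_le[OF F])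
  also have "\<dots> \<le> card ?F" using sum_bounded_above[of ?F "\<lambda>W. card (?M W)" 1] one by simp
  finally have "card (\<Union>W\<in>?F. ?M W) \<le> n" using card_F by simp
  then show "finite {K \<in> (\<Union>W\<in>\<B>. ?comp W). K \<inter> A \<noteq> {}} \<and>
      card {K \<in> (\<Union>W\<in>\<B>. ?comp W). K \<inter> A \<noteq> {}} \<le> n"
    using sub fin by (meson card_mono finite_subset le_trans)
qed

lemma nagata_dim_le_of_lipschitz_light:
  assumes "lipschitz_light X Y f"
  shows "nagata_dim X \<le> nagata_dim Y"
proof -
  from assms obtain C where f: "f \<in> mspace X \<rightarrow> mspace Y" and C: "C > 0"
    and lip: "\<forall>x\<in>mspace X. \<forall>y\<in>mspace X. mdist Y (f x) (f y) \<le> C * mdist X x y"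
    and light: "\<forall>r>0. \<forall>W. W \<subseteq> mspace Y \<and> mdiam Y W \<le> ennreal r \<longrightarrow>
        (\<forall>K \<in> r_components (submetric X {x \<in> mspace X. f x \<in> W}) r. mdiam X K \<le> ennreal (C * r))"
    unfolding lipschitz_light_def by (elim conjE exE) (rule that)
  have "\<exists>c>0. \<forall>s>0. \<exists>\<B>. covering X \<B> \<and> family_bounded X (c * s) \<B> \<and> multiplicity_at_most X s n \<B>"
    if "c > 0" and Y: "\<forall>s>0. \<exists>\<B>. covering Y \<B> \<and> family_bounded Y (c * s) \<B> \<and>
      multiplicity_at_most Y s n \<B>" for c n
  proof (intro exI[of _ "C * max (c * C) 1"] conjI allI impI)
    show "0 < C * max (c * C) 1" using C by simp
    fix s :: real assume s: "s > 0"
    then obtain \<B> where \<B>: "covering Y \<B>" "family_bounded Y (c * (C * s)) \<B>"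
        "multiplicity_at_most Y (C * s) n \<B>"
      using Y C by (meson mult_pos_pos)
    \<comment> \<open>The larger of the test scale \<open>s\<close> and the diameter bound \<open>c * (C * s)\<close> of the sets in \<open>\<B>\<close>.\<close>
    define r where "r = max (c * C) 1 * s"
    have r: "s \<le> r" "c * (C * s) \<le> r" "r > 0"
      using s mult_right_mono[of 1 "max (c * C) 1" s] mult_right_mono[of "c * C" "max (c * C) 1" s]
      by (auto simp: r_def mult.assoc)
    let ?\<C> = "\<Union>W\<in>\<B>. r_components (submetric X {x \<in> mspace X. f x \<in> W}) r"
    have "family_bounded X (C * max (c * C) 1 * s) ?\<C>"
      unfolding family_bounded_def
    proof clarify
      fix W K assume W: "W \<in> \<B>" and K: "K \<in> r_components (submetric X {x \<in> mspace X. f x \<in> W}) r"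
      have "W \<subseteq> mspace Y" using \<B>(1) W by (auto simp: covering_def)
      moreover have "mdiam Y W \<le> ennreal r"
        using \<B>(2) W r(2) by (meson ennreal_leI family_bounded_def order_trans)
      ultimately show "mdiam X K \<le> ennreal (C * max (c * C) 1 * s)"
        using light r(3) K by (simp add: r_def mult.assoc)
    qed
    then show "\<exists>\<B>. covering X \<B> \<and> family_bounded X (C * max (c * C) 1 * s) \<B> \<and>
        multiplicity_at_most X s n \<B>"
      using light_pullback_covering[OF \<B>(1) f]
        light_pullback_multiplicity[OF f lip C s r(1) \<B>(3)] by blast
  qed
  then show ?thesis unfolding nagata_dim_def by (intro Inf_superset_mono) blast
qed

section \<open>Kolmogorov's families of cubes\<close>

text \<open>
  The block \<open>j\<close> of colour \<open>k\<close> is the union of the intervals numbered \<open>m\<close> with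
  \<open>j * (n + 1) + k < m < (j + 1) * (n + 1) + k\<close>, and \<open>j\<close> selects one block per coordinate.
\<close>

definition kolmogorov_cube :: "nat \<Rightarrow> real \<Rightarrow> nat \<Rightarrow> (nat \<Rightarrow> int) \<Rightarrow> (nat \<Rightarrow> real) set" where
  "kolmogorov_cube n t k j = {x \<in> mspace (Rn_metric n). \<forall>i<n.
     (\<lfloor>x i / t\<rfloor> - int k) mod int (n + 1) \<noteq> 0 \<and> (\<lfloor>x i / t\<rfloor> - int k) div int (n + 1) = j i}"

text \<open>
  This is the separation of blocks: leaving a block of non-multiples of \<open>N\<close> requires jumping over a
  multiple of \<open>N\<close>.
\<close>

lemma div_eq_if_adjacent_nonmultiples:
  fixes a b N :: int
  assumes N: "N > 0" and close: "\<bar>a - b\<bar> \<le> 1" and nz: "a mod N \<noteq> 0" "b mod N \<noteq> 0"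
  shows "a div N = b div N"
proof -
  have le: "x div N \<le> y div N"
    if "\<bar>x - y\<bar> \<le> 1" "x mod N \<noteq> 0" "y mod N \<noteq> 0" for x y
  proof (rule ccontr)
    assume "\<not> ?thesis"
    then have "N * (y div N) + N \<le> N * (x div N)"
      using mult_left_mono[of "y div N + 1" "x div N" N] N by (simp add: distrib_left)
    moreover have "x = N * (x div N) + x mod N" "y = N * (y div N) + y mod N" by simp_all
    moreover have "x mod N > 0" "y mod N < N"
      using that(2) N pos_mod_sign[of N x] pos_mod_bound[of N y] by linarith+
    ultimately show False using that(1) by linarith
  qed
  show ?thesis using le[of a b] le[of b a] close nz by (simp add: abs_minus_commute)
qed

lemma abs_coord_le_mdist_Rn:
  assumes "i < n"
  shows "\<bar>x i - y i\<bar> \<le> mdist (Rn_metric n) x y"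
proof -
  have "\<bar>x i - y i\<bar> \<le> L2_set (\<lambda>i. \<bar>x i - y i\<bar>) {..<n}"
    using assms by (intro member_le_L2_set) auto
  then show ?thesis by (simp add: L2_set_def)
qed

lemma kolmogorov_cube_separated:
  assumes t: "t > 0" and x: "x \<in> kolmogorov_cube n t k j" and y: "y \<in> kolmogorov_cube n t k j'"
    and close: "mdist (Rn_metric n) x y \<le> t"
  shows "kolmogorov_cube n t k j = kolmogorov_cube n t k j'"
proof -
  have "j i = j' i" if i: "i < n" for i
  proof -
    have "\<bar>x i - y i\<bar> \<le> t" using abs_coord_le_mdist_Rn[OF i] close by (rule order_trans)
    then have "\<bar>x i / t - y i / t\<bar> \<le> 1"
      using t by (simp add: diff_divide_distrib[symmetric])
    then have "\<bar>\<lfloor>x i / t\<rfloor> - \<lfloor>y i / t\<rfloor>\<bar> \<le> 1" by linarith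
    then have "(\<lfloor>x i / t\<rfloor> - int k) div int (n + 1) = (\<lfloor>y i / t\<rfloor> - int k) div int (n + 1)"
      using x y i by (intro div_eq_if_adjacent_nonmultiples) (auto simp: kolmogorov_cube_def)
    then show ?thesis using x y i by (simp add: kolmogorov_cube_def)
  qed
  then show ?thesis by (simp add: kolmogorov_cube_def)
qed

lemma kolmogorov_cube_bounded:
  assumes t: "t > 0"
  shows "mdiam (Rn_metric n) (kolmogorov_cube n t k j) \<le> ennreal (real n * real (n + 1) * t)"
proof -
  have "mdist (Rn_metric n) x y \<le> real n * real (n + 1) * t"
    if xy: "x \<in> kolmogorov_cube n t k j" "y \<in> kolmogorov_cube n t k j" for x y
  proof -
    have "\<bar>x i - y i\<bar> \<le> real (n + 1) * t" if i: "i < n" for i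
    proof -
      define N a b where "N = int (n + 1)" and "a = \<lfloor>x i / t\<rfloor> - int k" and "b = \<lfloor>y i / t\<rfloor> - int k"
      have "a div N = b div N"
        using xy i by (simp add: kolmogorov_cube_def a_def b_def N_def)
      then have "a - b = a mod N - b mod N"
        by (simp add: minus_mult_div_eq_mod[symmetric])
      moreover have "0 \<le> a mod N" "a mod N < N" "0 \<le> b mod N" "b mod N < N"
        by (simp_all add: N_def)
      ultimately have "\<bar>a - b\<bar> \<le> int n" unfolding N_def by linarith
      then have "\<bar>\<lfloor>x i / t\<rfloor> - \<lfloor>y i / t\<rfloor>\<bar> \<le> int n" by (simp add: a_def b_def)
      then have "\<bar>x i / t - y i / t\<bar> \<le> real (n + 1)" by linarith
      then show ?thesis
        using t by (simp add: diff_divide_distrib[symmetric] pos_divide_le_eq)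
    qed
    then have "(\<Sum>i<n. \<bar>x i - y i\<bar>) \<le> (\<Sum>i<n. real (n + 1) * t)" by (intro sum_mono) simp
    moreover have "mdist (Rn_metric n) x y \<le> (\<Sum>i<n. \<bar>x i - y i\<bar>)"
      using L2_set_le_sum_abs[of "\<lambda>i. x i - y i" "{..<n}"] by simp
    ultimately show ?thesis by (simp add: mult.assoc)
  qed
  then show ?thesis using t by (subst mdiam_le_iff) auto
qed

lemma kolmogorov_cubes_cover:
  assumes x: "x \<in> mspace (Rn_metric n)"
  shows "\<exists>k\<le>n. \<exists>j. x \<in> kolmogorov_cube n t k j"
proof -
  \<comment> \<open>The colours forbidden by the \<open>n\<close> coordinates cannot exhaust \<open>n + 1\<close> colours.\<close>
  let ?bad = "(\<lambda>i. nat (\<lfloor>x i / t\<rfloor> mod int (n + 1))) ` {..<n}"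
  have "card ?bad \<le> n" using card_image_le[of "{..<n}"] by simp
  then have "\<not> {..n} \<subseteq> ?bad" using card_mono[of ?bad "{..n}"] by auto
  then obtain k where k: "k \<le> n" "k \<notin> ?bad" by auto
  have "(\<lfloor>x i / t\<rfloor> - int k) mod int (n + 1) \<noteq> 0" if "i < n" for i
  proof
    assume "(\<lfloor>x i / t\<rfloor> - int k) mod int (n + 1) = 0"
    then have "\<lfloor>x i / t\<rfloor> mod int (n + 1) = int k mod int (n + 1)"
      by (simp add: mod_eq_dvd_iff dvd_eq_mod_eq_0)
    then have "k = nat (\<lfloor>x i / t\<rfloor> mod int (n + 1))" using k(1) by simp
    then show False using k(2) that by blast
  qed
  then have "x \<in> kolmogorov_cube n t k (\<lambda>i. (\<lfloor>x i / t\<rfloor> - int k) div int (n + 1))"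
    using x by (simp add: kolmogorov_cube_def)
  then show ?thesis using k(1) by blast
qed

lemma nagata_dim_Rn_le: "nagata_dim (Rn_metric n) \<le> enat n"
proof -
  let ?R = "Rn_metric n"
  have "\<exists>c>0. \<forall>s>0. \<exists>\<B>. covering ?R \<B> \<and> family_bounded ?R (c * s) \<B> \<and>
      multiplicity_at_most ?R s (n + 1) \<B>"
  \<comment> \<open>The summand \<open>1\<close> keeps the constant positive when \<open>n = 0\<close>.\<close>
  proof (intro exI[of _ "real n * real (n + 1) + 1"] conjI allI impI)
    show "0 < real n * real (n + 1) + 1" by (simp add: add_nonneg_pos)
    fix t :: real assume t: "t > 0"
    let ?\<B> = "\<Union>k\<le>n. range (kolmogorov_cube n t k)"
    have "covering ?R ?\<B>"
      unfolding covering_def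
    proof (intro conjI equalityI subsetI ballI)
      fix x assume "x \<in> mspace ?R"
      then show "x \<in> \<Union>?\<B>" using kolmogorov_cubes_cover[of x n t] by blast
    qed (auto simp: kolmogorov_cube_def)
    moreover have "family_bounded ?R ((real n * real (n + 1) + 1) * t) ?\<B>"
    proof -
      have "ennreal (real n * real (n + 1) * t) \<le> ennreal ((real n * real (n + 1) + 1) * t)"
        using t by (intro ennreal_leI) (simp add: distrib_right)
      then show ?thesis
        using kolmogorov_cube_bounded[OF t] unfolding family_bounded_def
        by (blast intro: order_trans)
    qed
    moreover have "multiplicity_at_most ?R t (n + 1) ?\<B>"
      unfolding multiplicity_at_most_def
    proof (intro allI impI, elim conjE)
      fix A assume "A \<subseteq> mspace ?R" and "mdiam ?R A \<le> ennreal t"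
      then have dA: "mdist ?R x y \<le> t" if "x \<in> A" "y \<in> A" for x y
        using t that mdiam_le_iff[of t ?R A] by (meson less_imp_le)
      have "\<exists>B. \<forall>j. kolmogorov_cube n t k j \<inter> A \<noteq> {} \<longrightarrow> kolmogorov_cube n t k j = B" for k
      proof (cases "\<exists>j0. kolmogorov_cube n t k j0 \<inter> A \<noteq> {}")
        case True
        then obtain j0 y where y: "y \<in> kolmogorov_cube n t k j0" "y \<in> A" by blast
        have "kolmogorov_cube n t k j = kolmogorov_cube n t k j0"
          if "x \<in> kolmogorov_cube n t k j" "x \<in> A" for j x
          using kolmogorov_cube_separated[OF t that(1) y(1) dA[OF that(2) y(2)]] .
        then show ?thesis by blast
      qed blast
      then obtain b where
        b: "\<And>k j. kolmogorov_cube n t k j \<inter> A \<noteq> {} \<Longrightarrow> kolmogorov_cube n t k j = b k"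
        by metis
      have sub: "{B \<in> ?\<B>. B \<inter> A \<noteq> {}} \<subseteq> b ` {..n}" using b by fastforce
      have "card (b ` {..n}) \<le> n + 1" using card_image_le[of "{..n}" b] by simp
      with sub show "finite {B \<in> ?\<B>. B \<inter> A \<noteq> {}} \<and> card {B \<in> ?\<B>. B \<inter> A \<noteq> {}} \<le> n + 1"
        by (meson card_mono finite_atMost finite_imageI finite_subset le_trans)
    qed
    ultimately show "\<exists>\<B>. covering ?R \<B> \<and>
        family_bounded ?R ((real n * real (n + 1) + 1) * t) \<B> \<and> multiplicity_at_most ?R t (n + 1) \<B>"
      by blast
  qed
  then show ?thesis unfolding nagata_dim_def by (intro Inf_lower) blast
qed

section \<open>Comparison of the two dimensions\<close>

theorem corollary6p2:
  fixes X :: "'a metric"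
  shows "nagata_dim X \<le> lipschitz_dim X"
  unfolding lipschitz_dim_def
proof (rule Inf_greatest, clarify)
  fix n f assume "lipschitz_light X (Rn_metric n) f"
  then show "nagata_dim X \<le> enat n"
    using nagata_dim_le_of_lipschitz_light nagata_dim_Rn_le by (blast intro: order_trans)
qed

end
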